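(* Let $\Omega\subseteq\mathbb{R}^n$ be closed, let $\Xi\subseteq\Omega$ be a Borel set, let $g,h_0,\dots,h_m:\Omega\to\mathbb{R}$ be measurable with $h_0\equiv 1$, let $\mathbf{q}=(q_0,\dots,q_m)$ with $q_0=1$, and let $\mathcal{P}_0$ be a convex set of probability measures on $\Omega$ generated by a class $\mathcal{T}\subseteq\mathcal{P}_0$ of extremal distributions. Put $$\mathcal{P}(\mathbf{q})=\Big\{\mathbb{P}\in\mathcal{P}_0:\int_\Omega h_j\,\mathrm{d}\mathbb{P}=q_j,\ j=0,\dots,m\Big\},$$ and let $\mathcal{D}(\mathbf{q})$ be the set of basic distributions, i.e. those elements of $\mathcal{P}(\mathbf{q})$ that are convex combinations of at most $m+1$ elements of $\mathcal{T}$. Suppose that: (A1) $g$ is bounded on $\Omega$; (A2) there exists $\epsilon>0$ such that $\inf_{\mathbb{P}\in\mathcal{P}(\mathbf{q})}\mathbb{P}(X\in\Xi)\ge\epsilon$; (A3) $\mathbf{q}$ lies in the interior of the moment cone $\mathcal{Q}_{\mathcal P}$. Then $$\sup_{\mathbb{P}\in\mathcal{P}(\mathbf{q})}\mathbb{E}_{\mathbb{P}}[g(X)\mid X\in\Xi]=\sup_{\mathbb{P}\in\mathcal{D}(\mathbf{q})}\mathbb{E}_{\mathbb{P}}[g(X)\mid X\in\Xi].$$ Moreover, if the optimal value is attained, then there exists an optimal basic distribution, i.e. a convex combination of $m+1$ probability distributions from the generating set $\mathcal{T}$, that achieves this value.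
   Context: $X$ is the random vector with law $\mathbb{P}$ on $\Omega$; $\mathbf{1}_\Xi$ is the indicator function of $\Xi$. The conditional expectation is $\mathbb{E}_{\mathbb{P}}[g(X)\mid X\in\Xi]=\mathbb{E}_{\mathbb{P}}[g(X)\mathbf{1}_\Xi(X)]/\mathbb{E}_{\mathbb{P}}[\mathbf{1}_\Xi(X)]$, for $\mathbb{P}(X\in\Xi)>0$. The functions $h_j$ are integrable with respect to all measures considered, and $\mathcal{P}(\mathbf{q})$ is nonempty. "$\mathcal{P}_0$ is generated by $\mathcal{T}$" means: $\mathcal{T}=\{\mathbb{T}_{\mathbf{t}}\}$ is a (finite-dimensionally) parameterized family of distributions contained in $\mathcal{P}_0$, consisting of its extreme points, such that every $\mathbb{P}\in\mathcal{P}_0$ is a mixture of elements of $\mathcal{T}$: there is a probability measure $\mathbb{M}$ on the parameter set such that $\mathbb{P}(X\in\mathcal{S})=\int\mathbb{T}_{\mathbf{t}}(X\in\mathcal{S})\,\mathrm{d}\mathbb{M}(\mathbf{t})$ for every Borel set $\mathcal{S}\subseteq\Omega$. The moment cone is $\mathcal{Q}_{\mathcal P}=\{(\int h_0\,\mathrm{d}\rho,\dots,\int h_m\,\mathrm{d}\rho):\rho\in\mathcal{A}\}\subseteq\mathbb{R}^{m+1}$, where $\mathcal{A}=\{c\,\mathbb{P}:c\ge0,\ \mathbb{P}\in\mathcal{P}_0\}$ is the cone of measures generated by $\mathcal{P}_0$. A convex combination may have zero weights. *)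

theory Defs
  imports "HOL-Probability.Probability"
begin

text \<open>
  Probability laws on \<open>\<Omega>\<close> live on the trace Borel sigma-algebra, so their space is
  \<open>\<Omega>\<close> itself and only the values of functions on \<open>\<Omega>\<close> matter. Such measures are equal as
  soon as they agree on all Borel subsets of \<open>\<Omega>\<close>.
\<close>

definition prob_laws :: "'a::topological_space set \<Rightarrow> 'a measure set" where
  "prob_laws \<Omega> = {P. prob_space P \<and> sets P = sets (restrict_space borel \<Omega>)}"

text \<open>
  Measures form no vector space in the library, so convex combinations are expressed
  setwise. These predicates are only meant for probability measures.
\<close>

definition is_mix :: "real \<Rightarrow> 'a measure \<Rightarrow> 'a measure \<Rightarrow> 'a measure \<Rightarrow> bool" where
  "is_mix a P Q R \<longleftrightarrow> sets P = sets R \<and> sets Q = sets R \<and>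
     (\<forall>S\<in>sets R. measure R S = a * measure P S + (1 - a) * measure Q S)"

definition convex_class :: "'a measure set \<Rightarrow> bool" where
  "convex_class \<P>\<^sub>0 \<longleftrightarrow> (\<forall>P\<in>\<P>\<^sub>0. \<forall>Q\<in>\<P>\<^sub>0. \<forall>a\<in>{0..1}. \<exists>R\<in>\<P>\<^sub>0. is_mix a P Q R)"

definition extreme_law :: "'a measure \<Rightarrow> 'a measure set \<Rightarrow> bool" where
  "extreme_law P \<P>\<^sub>0 \<longleftrightarrow> P \<in> \<P>\<^sub>0 \<and>
     (\<forall>Q\<in>\<P>\<^sub>0. \<forall>R\<in>\<P>\<^sub>0. \<forall>a. 0 < a \<and> a < 1 \<and> is_mix a Q R P \<longrightarrow> Q = R)"

text \<open>
  A combination of \<open>k\<close> elements of \<open>\<T>\<close>; zero weights and repetitions are allowed, so this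
  makes sense even if \<open>\<T>\<close> has fewer than \<open>k\<close> elements.
\<close>

definition convex_comb_of :: "nat \<Rightarrow> 'a measure set \<Rightarrow> 'a measure \<Rightarrow> bool" where
  "convex_comb_of k \<T> R \<longleftrightarrow> (\<exists>w \<mu>.
     (\<forall>i<k. 0 \<le> w i \<and> \<mu> i \<in> \<T> \<and> sets (\<mu> i) = sets R) \<and> (\<Sum>i<k. w i) = (1::real) \<and>
     (\<forall>S\<in>sets R. measure R S = (\<Sum>i<k. w i * measure (\<mu> i) S)))"

text \<open>
  The family \<open>T t\<close>, \<open>t \<in> \<Theta>\<close>, generates \<open>\<P>\<^sub>0\<close>. The measurability clause is what
  gives the mixing integrals their meaning; \<open>\<Theta>\<close> carries its trace Borel sigma-algebra.
\<close>

definition generated_by ::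
  "'a::topological_space set \<Rightarrow> 'a measure set \<Rightarrow> (real^'k) set \<Rightarrow> (real^'k \<Rightarrow> 'a measure) \<Rightarrow> bool" where
  "generated_by \<Omega> \<P>\<^sub>0 \<Theta> T \<longleftrightarrow>
     (\<forall>t\<in>\<Theta>. extreme_law (T t) \<P>\<^sub>0) \<and>
     (\<forall>S\<in>sets (restrict_space borel \<Omega>).
        (\<lambda>t. measure (T t) S) \<in> borel_measurable (restrict_space borel \<Theta>)) \<and>
     (\<forall>P\<in>\<P>\<^sub>0. \<exists>M\<in>prob_laws \<Theta>.
        \<forall>S\<in>sets (restrict_space borel \<Omega>). measure P S = (\<integral>t. measure (T t) S \<partial>M))"

definition moment_class ::
  "'a measure set \<Rightarrow> ('j::finite \<Rightarrow> 'a \<Rightarrow> real) \<Rightarrow> real^'j \<Rightarrow> 'a measure set" where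
  "moment_class \<P>\<^sub>0 h q = {P\<in>\<P>\<^sub>0. \<forall>j. (\<integral>x. h j x \<partial>P) = q $ j}"

text \<open>The index type has \<open>m + 1\<close> elements, so \<open>CARD('j)\<close> is the admissible number of components.\<close>

definition basic_class ::
  "'a measure set \<Rightarrow> 'a measure set \<Rightarrow> ('j::finite \<Rightarrow> 'a \<Rightarrow> real) \<Rightarrow> real^'j \<Rightarrow> 'a measure set" where
  "basic_class \<P>\<^sub>0 \<T> h q =
     {P\<in>moment_class \<P>\<^sub>0 h q. \<exists>k\<le>CARD('j). convex_comb_of k \<T> P}"

definition cone_of_measures :: "'a measure set \<Rightarrow> 'a measure set" where
  "cone_of_measures \<P>\<^sub>0 = {scale_measure (ennreal c) P | c P. 0 \<le> c \<and> P \<in> \<P>\<^sub>0}"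

definition moment_cone ::
  "'a measure set \<Rightarrow> ('j::finite \<Rightarrow> 'a \<Rightarrow> real) \<Rightarrow> (real^'j) set" where
  "moment_cone \<P>\<^sub>0 h = (\<lambda>\<rho>. \<chi> j. \<integral>x. h j x \<partial>\<rho>) ` cone_of_measures \<P>\<^sub>0"

definition cond_expect :: "'a measure \<Rightarrow> ('a \<Rightarrow> real) \<Rightarrow> 'a set \<Rightarrow> real" where
  "cond_expect P g \<Xi> = (\<integral>x. g x * indicator \<Xi> x \<partial>P) / (\<integral>x. indicator \<Xi> x \<partial>P)"

end

theory Submission imports Defs begin

text \<open>
  The theorem follows from a linear statement of the Richter--Rogosinski type,
  \<open>exists_basic_law_dominating\<close>: for every law \<open>P\<close> of the class and every
  function \<open>f\<close> that is integrable under all of its laws, there is a mixture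
  \<open>Q\<close> of at most \<open>m + 1\<close> generating laws that has the same moments as \<open>P\<close> and satisfies \<open>\<integral> f dP \<le> \<integral> f dQ\<close>. The conditional expectation is a ratio and not linear
  in the law, but comparisons with a fixed number \<open>v\<close> are linear. Take \<open>v\<close> to be the value at
  \<open>P\<close> and \<open>f = (g - v) 1\<^sub>\<Xi>\<close>. Then \<open>\<integral> f dP = 0\<close>, hence \<open>\<integral> f dQ \<ge> 0\<close>, and
  dividing by \<open>Q(\<Xi>)\<close>, which is positive by (A2), shows that the value at \<open>Q\<close> is at least
  \<open>v\<close>. Since each feasible law is dominated by a basic one, both the equality of the suprema and
  the statement on attainment follow.

  For the linear statement, write \<open>P\<close> as the mixture of the generating laws under a mixing law
  \<open>M\<close> and map a parameter \<open>t\<close> to the vector of the moments of \<open>T t\<close> together with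
  \<open>\<integral> f dT t\<close>. The corresponding vector of \<open>P\<close> is the mean of this map under \<open>M\<close>
  (\<open>integral_mixture\<close>), and a mean of a vector-valued random variable in finite dimension lies in
  the convex hull of its values (\<open>expectation_in_convex_hull_of_AE\<close>). So finitely many generating
  laws already reproduce the moments and the integral of \<open>f\<close>. The weights of such a representation
  are a feasible point of a linear programme with \<open>m + 1\<close> equality constraints, one of which is
  the normalisation, and passing to a basic solution that is no worse leaves at most \<open>m + 1\<close>
  of them (\<open>reduce_support\<close>).
\<close>

section \<open>Integrals against a mixture\<close>

text \<open>
  A measure that is setwise the mixture of a measurable family is the monadic bind of the
  mixing law with that family, viewed as a Markov kernel. The change of the order of integration
  is then available for all nonnegative measurable functions, and an integrable
  function is the difference of its positive and negative parts. Integrability with respect to every single component makes the inner integrals of both parts finite, so that the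
  difference can be taken pointwise in the parameter.
\<close>

lemma integral_mixture:
  fixes f :: "'a \<Rightarrow> real"
  assumes M: "prob_space M"
    and P: "prob_space P"
    and K: "\<And>t. t \<in> space M \<Longrightarrow> prob_space (K t)"
    and sets_K: "\<And>t. t \<in> space M \<Longrightarrow> sets (K t) = sets P"
    and meas_K: "\<And>S. S \<in> sets P \<Longrightarrow> (\<lambda>t. measure (K t) S) \<in> borel_measurable M"
    and mix: "\<And>S. S \<in> sets P \<Longrightarrow> measure P S = (\<integral>t. measure (K t) S \<partial>M)"
    and f: "integrable P f"
    and f_K: "\<And>t. t \<in> space M \<Longrightarrow> integrable (K t) f"
  shows "integrable M (\<lambda>t. \<integral>x. f x \<partial>K t)"
    and "(\<integral>x. f x \<partial>P) = (\<integral>t. (\<integral>x. f x \<partial>K t) \<partial>M)"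
proof -
  interpret M: prob_space M by fact
  interpret P: prob_space P by fact
  have emK: "emeasure (K t) S = ennreal (measure (K t) S)" if "t \<in> space M" for t S
    using prob_space.finite_measure[OF K[OF that]] by (rule finite_measure.emeasure_eq_measure)
  have kernel: "K \<in> measurable M (subprob_algebra P)"
  proof (rule measurable_subprob_algebra)
    fix S assume "S \<in> sets P"
    then have "(\<lambda>t. ennreal (measure (K t) S)) \<in> borel_measurable M"
      using meas_K by measurable
    then show "(\<lambda>t. emeasure (K t) S) \<in> borel_measurable M"
      by (subst measurable_cong[OF emK])
  qed (auto simp: K sets_K prob_space_imp_subprob_space)
  have P_bind: "P = M \<bind> K"
  proof (rule measure_eqI)
    show "sets P = sets (M \<bind> K)"
      by (simp add: sets_bind[OF sets_K] M.not_empty)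
    fix S assume S: "S \<in> sets P"
    have int: "integrable M (\<lambda>t. measure (K t) S)"
      by (rule M.integrable_const_bound[where B=1])
         (use S in \<open>auto intro!: meas_K prob_space.prob_le_1 K\<close>)
    have "emeasure (M \<bind> K) S = (\<integral>\<^sup>+t. emeasure (K t) S \<partial>M)"
      by (rule emeasure_bind[OF M.not_empty kernel S])
    also have "\<dots> = (\<integral>\<^sup>+t. ennreal (measure (K t) S) \<partial>M)"
      by (intro nn_integral_cong emK)
    also have "\<dots> = ennreal (measure P S)"
      by (simp add: nn_integral_eq_integral[OF int] mix[OF S])
    finally show "emeasure P S = emeasure (M \<bind> K) S"
      by (simp add: P.emeasure_eq_measure)
  qed
  have part: "integrable M (\<lambda>t. enn2real (\<integral>\<^sup>+x. ennreal (u x) \<partial>K t)) \<and>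
      enn2real (\<integral>\<^sup>+x. ennreal (u x) \<partial>P) = (\<integral>t. enn2real (\<integral>\<^sup>+x. ennreal (u x) \<partial>K t) \<partial>M)"
    if u: "integrable P u" "\<And>t. t \<in> space M \<Longrightarrow> integrable (K t) u" for u :: "'a \<Rightarrow> real"
  proof -
    have bind_u: "(\<integral>\<^sup>+x. ennreal (u x) \<partial>P) = (\<integral>\<^sup>+t. (\<integral>\<^sup>+x. ennreal (u x) \<partial>K t) \<partial>M)"
      by (subst P_bind, rule nn_integral_bind[OF _ kernel]) (use u in measurable)
    have meas_u: "(\<lambda>t. \<integral>\<^sup>+x. ennreal (u x) \<partial>K t) \<in> borel_measurable M"
      by (rule measurable_compose[OF kernel nn_integral_measurable_subprob_algebra])
         (use u in measurable)
    have "(\<integral>\<^sup>+x. ennreal (u x) \<partial>N) < \<infinity>" if "integrable N u" for N :: "'a measure"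
    proof -
      have "(\<integral>\<^sup>+x. ennreal (u x) \<partial>N) \<le> (\<integral>\<^sup>+x. ennreal (norm (u x)) \<partial>N)"
        by (intro nn_integral_mono ennreal_leI) simp
      also have "\<dots> < \<infinity>" using that by (simp add: integrable_iff_bounded)
      finally show ?thesis .
    qed
    then have fin_P: "(\<integral>\<^sup>+x. ennreal (u x) \<partial>P) < \<infinity>"
      and fin_K: "\<And>t. t \<in> space M \<Longrightarrow> (\<integral>\<^sup>+x. ennreal (u x) \<partial>K t) < \<infinity>"
      using u by auto
    have eq: "(\<integral>\<^sup>+t. ennreal (enn2real (\<integral>\<^sup>+x. ennreal (u x) \<partial>K t)) \<partial>M) = (\<integral>\<^sup>+x. ennreal (u x) \<partial>P)"
      unfolding bind_u by (rule nn_integral_cong) (use fin_K in \<open>auto simp: less_top\<close>)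
    have "integrable M (\<lambda>t. enn2real (\<integral>\<^sup>+x. ennreal (u x) \<partial>K t))"
      by (rule integrableI_nonneg) (use meas_u fin_P eq in auto)
    moreover have "(\<integral>t. enn2real (\<integral>\<^sup>+x. ennreal (u x) \<partial>K t) \<partial>M) = enn2real (\<integral>\<^sup>+x. ennreal (u x) \<partial>P)"
      by (subst integral_eq_nn_integral) (use meas_u eq in auto)
    ultimately show ?thesis by simp
  qed
  note pos = part[OF f f_K]
  have neg: "integrable M (\<lambda>t. enn2real (\<integral>\<^sup>+x. ennreal (- f x) \<partial>K t)) \<and>
      enn2real (\<integral>\<^sup>+x. ennreal (- f x) \<partial>P) = (\<integral>t. enn2real (\<integral>\<^sup>+x. ennreal (- f x) \<partial>K t) \<partial>M)"
    by (rule part) (use f f_K in auto)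
  have split_K: "(\<integral>x. f x \<partial>K t) = enn2real (\<integral>\<^sup>+x. ennreal (f x) \<partial>K t) -
      enn2real (\<integral>\<^sup>+x. ennreal (- f x) \<partial>K t)" if "t \<in> space M" for t
    by (rule real_lebesgue_integral_def[OF f_K[OF that]])
  have "integrable M (\<lambda>t. enn2real (\<integral>\<^sup>+x. ennreal (f x) \<partial>K t) -
      enn2real (\<integral>\<^sup>+x. ennreal (- f x) \<partial>K t))"
    using pos neg by (intro Bochner_Integration.integrable_diff) auto
  then show "integrable M (\<lambda>t. \<integral>x. f x \<partial>K t)"
    by (subst Bochner_Integration.integrable_cong[OF refl split_K])
  have "(\<integral>t. (\<integral>x. f x \<partial>K t) \<partial>M) = (\<integral>t. enn2real (\<integral>\<^sup>+x. ennreal (f x) \<partial>K t) -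
      enn2real (\<integral>\<^sup>+x. ennreal (- f x) \<partial>K t) \<partial>M)"
    by (rule Bochner_Integration.integral_cong[OF refl split_K])
  also have "\<dots> = (\<integral>x. f x \<partial>P)"
    using pos neg by (simp add: real_lebesgue_integral_def[OF f])
  finally show "(\<integral>x. f x \<partial>P) = (\<integral>t. (\<integral>x. f x \<partial>K t) \<partial>M)" ..
qed

text \<open>
  A finite mixture is the mixture whose mixing law is a point measure on the index set.
\<close>

lemma integral_finite_mixture:
  fixes f :: "'a \<Rightarrow> real"
  assumes I: "finite I" and w: "\<And>i. i \<in> I \<Longrightarrow> 0 \<le> w i" "(\<Sum>i\<in>I. w i) = 1"
    and P: "prob_space P"
    and K: "\<And>i. i \<in> I \<Longrightarrow> prob_space (K i)" "\<And>i. i \<in> I \<Longrightarrow> sets (K i) = sets P"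
    and mix: "\<And>S. S \<in> sets P \<Longrightarrow> measure P S = (\<Sum>i\<in>I. w i * measure (K i) S)"
    and f: "integrable P f" "\<And>i. i \<in> I \<Longrightarrow> integrable (K i) f"
  shows "(\<integral>x. f x \<partial>P) = (\<Sum>i\<in>I. w i * (\<integral>x. f x \<partial>K i))"
proof -
  let ?M = "point_measure I (\<lambda>i. ennreal (w i))"
  have M: "prob_space ?M"
    by (rule prob_spaceI)
       (simp add: space_point_measure emeasure_point_measure_finite[OF I] sum_ennreal w)
  have int_M: "(\<integral>i. v i \<partial>?M) = (\<Sum>i\<in>I. w i * v i)" for v :: "_ \<Rightarrow> real"
    using I w by (simp add: lebesgue_integral_point_measure_finite)
  have "(\<integral>x. f x \<partial>P) = (\<integral>i. (\<integral>x. f x \<partial>K i) \<partial>?M)"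
    by (rule integral_mixture(2)[OF M P])
       (auto simp: space_point_measure K mix int_M f)
  then show ?thesis by (simp add: int_M)
qed

section \<open>Barycentres in finite dimension\<close>

text \<open>
  In finite dimension the mean lies in the convex hull itself and not merely in its closure. If it
  did not, a hyperplane through the mean would have all values of \<open>X\<close> on one side; having mean
  zero, the distance to that hyperplane vanishes almost surely. Discarding the other
  sample points leaves a set of full measure whose image spans a smaller affine subspace, and the
  dimension cannot drop forever. The set \<open>A\<close> records the points that are still left.
\<close>

lemma (in prob_space) expectation_in_convex_hull_of_AE:
  fixes X :: "'a \<Rightarrow> 'b::euclidean_space"
  assumes X: "integrable M X" and A: "AE x in M. x \<in> A"
  shows "expectation X \<in> convex hull (X ` A)"
  using A
proof (induction "nat (aff_dim (X ` A) + 1)" arbitrary: A rule: less_induct)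
  case less
  let ?e = "expectation X"
  have "A \<noteq> {}" using less.prems AE_contr by auto
  show ?case
  proof (rule ccontr)
    assume "?e \<notin> convex hull (X ` A)"
    then obtain a b where a_in: "?e + a \<in> affine hull (insert ?e (convex hull (X ` A)))"
      and a: "a \<noteq> 0" "a \<bullet> ?e \<le> b" "\<And>y. y \<in> convex hull (X ` A) \<Longrightarrow> a \<bullet> y \<ge> b"
      using separating_hyperplane_set_point_inaff[of "convex hull (X ` A)" ?e] \<open>A \<noteq> {}\<close> by auto
    have ge: "a \<bullet> X x \<ge> a \<bullet> ?e" if "x \<in> A" for x
      using a(2) a(3)[of "X x"] that hull_inc[of "X x" "X ` A"] by force
    have int_a: "integrable M (\<lambda>x. a \<bullet> X x - a \<bullet> ?e)" using X by auto
    have "expectation (\<lambda>x. a \<bullet> X x - a \<bullet> ?e) = 0"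
      using X by (simp add: prob_space)
    moreover have "AE x in M. 0 \<le> a \<bullet> X x - a \<bullet> ?e"
      using less.prems by eventually_elim (use ge in auto)
    ultimately have zero: "AE x in M. a \<bullet> X x - a \<bullet> ?e = 0"
      using integral_nonneg_eq_0_iff_AE[OF int_a] by simp
    define B where "B = {x \<in> A. a \<bullet> X x = a \<bullet> ?e}"
    let ?H = "{y. a \<bullet> y = a \<bullet> ?e}"
    have B: "AE x in M. x \<in> B"
      using zero less.prems by eventually_elim (auto simp: B_def)
    have "B \<noteq> {}" using B AE_contr by auto
    have B_H: "affine hull (X ` B) \<subseteq> ?H"
      by (rule hull_minimal) (auto simp: B_def affine_hyperplane)
    \<comment> \<open>The normal vector of the separating hyperplane can be chosen parallel to the affine hull of
      the image and the mean, so the hyperplane cuts that hull properly.\<close>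
    have "\<not> X ` A \<subseteq> ?H"
    proof
      assume "X ` A \<subseteq> ?H"
      then have "convex hull (X ` A) \<subseteq> ?H"
        by (intro hull_minimal) (auto intro: affine_imp_convex affine_hyperplane)
      then have "affine hull (insert ?e (convex hull (X ` A))) \<subseteq> ?H"
        by (intro hull_minimal) (auto simp: affine_hyperplane)
      with a_in have "a \<bullet> (?e + a) = a \<bullet> ?e" by blast
      with a(1) show False by (simp add: inner_add_right)
    qed
    then have "affine hull (X ` B) \<subset> affine hull (X ` A)"
      using B_H hull_subset[of "X ` A" affine] hull_mono[of "X ` B" "X ` A" affine]
      by (auto simp: B_def)
    then have "aff_dim (X ` B) < aff_dim (X ` A)" by (rule aff_dim_psubset)
    moreover have "aff_dim (X ` B) \<ge> 0" using \<open>B \<noteq> {}\<close>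
      by (simp add: linorder_not_less[symmetric])
    ultimately have "?e \<in> convex hull (X ` B)"
      using less.hyps[of B] B by simp
    also have "\<dots> \<subseteq> convex hull (X ` A)" by (intro hull_mono) (auto simp: B_def)
    finally show False using \<open>?e \<notin> _\<close> by contradiction
  qed
qed

section \<open>Reduction to basic solutions\<close>

text \<open>
  The family may repeat a vector: a repetition is a relation by itself, and without repetitions
  the vectors form a set that is too large to be independent.
\<close>

lemma nontrivial_relation_of_card:
  fixes \<phi> :: "'i \<Rightarrow> 'v::euclidean_space"
  assumes I: "finite I" and card: "card I > DIM('v)"
  shows "\<exists>c. (\<Sum>i\<in>I. c i *\<^sub>R \<phi> i) = 0 \<and> (\<exists>i\<in>I. c i \<noteq> 0)"
proof (cases "inj_on \<phi> I")
  case True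
  then have "dependent (\<phi> ` I)"
    using card by (intro dependent_biggerset) (simp add: card_image)
  then obtain d where "(\<Sum>v\<in>\<phi> ` I. d v *\<^sub>R v) = 0" "\<exists>v\<in>\<phi> ` I. d v \<noteq> 0"
    using I by (auto simp: real_vector.dependent_finite)
  with True show ?thesis
    by (intro exI[of _ "d \<circ> \<phi>"]) (auto simp: sum.reindex)
next
  case False
  then obtain i k where ik: "i \<in> I" "k \<in> I" "i \<noteq> k" "\<phi> i = \<phi> k" by (auto simp: inj_on_def)
  define c where "c = (\<lambda>j. if j = i then 1 else if j = k then -1 else (0::real))"
  have "(\<Sum>j\<in>I. c j *\<^sub>R \<phi> j) = (\<Sum>j\<in>{i,k}. c j *\<^sub>R \<phi> j)"
    using I ik by (intro sum.mono_neutral_right) (auto simp: c_def)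
  also have "\<dots> = 0" using ik by (simp add: c_def)
  finally show ?thesis using ik by (intro exI[of _ c]) (auto simp: c_def)
qed

text \<open>
  This is the existence of basic solutions in linear programming. As long as there are more vectors
  than dimensions, the weights can be moved along a linear relation among the vectors without
  changing the weighted sum, and the sign of the relation can be chosen such that the objective
  does not decrease. Pairing with \<open>e\<close> shows that the coefficients of the relation sum to zero,
  so some are negative and the movement must reach a zero weight; that index is dropped.
\<close>

lemma reduce_support:
  fixes \<phi> :: "'i \<Rightarrow> 'v::euclidean_space" and \<psi> w :: "'i \<Rightarrow> real"
  assumes "finite I" and "\<And>i. i \<in> I \<Longrightarrow> \<phi> i \<bullet> e = 1" and "\<And>i. i \<in> I \<Longrightarrow> 0 \<le> w i"
  shows "\<exists>J u. J \<subseteq> I \<and> card J \<le> DIM('v) \<and> (\<forall>i\<in>J. 0 \<le> u i) \<and>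
    (\<Sum>i\<in>J. u i *\<^sub>R \<phi> i) = (\<Sum>i\<in>I. w i *\<^sub>R \<phi> i) \<and>
    (\<Sum>i\<in>J. u i * \<psi> i) \<ge> (\<Sum>i\<in>I. w i * \<psi> i)"
  using assms
proof (induction I arbitrary: w rule: finite_psubset_induct)
  case (psubset I)
  show ?case
  proof (cases "card I \<le> DIM('v)")
    case True
    then show ?thesis using psubset.prems by (intro exI[of _ I] exI[of _ w]) auto
  next
    case False
    then obtain c' where c': "(\<Sum>i\<in>I. c' i *\<^sub>R \<phi> i) = 0" "\<exists>i\<in>I. c' i \<noteq> 0"
      using nontrivial_relation_of_card[OF psubset.hyps, of \<phi>] by auto
    define c where "c = (if (\<Sum>i\<in>I. c' i * \<psi> i) \<ge> 0 then c' else (\<lambda>i. - c' i))"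
    have c: "(\<Sum>i\<in>I. c i *\<^sub>R \<phi> i) = 0" "\<exists>i\<in>I. c i \<noteq> 0" "(\<Sum>i\<in>I. c i * \<psi> i) \<ge> 0"
      using c' by (auto simp: c_def sum_negf)
    have "(\<Sum>i\<in>I. c i) = (\<Sum>i\<in>I. c i *\<^sub>R \<phi> i) \<bullet> e"
      using psubset.prems(1) by (simp add: inner_sum_left)
    then have sum_c: "(\<Sum>i\<in>I. c i) = 0" using c(1) by simp
    define N where "N = {i \<in> I. c i < 0}"
    have "N \<noteq> {}"
    proof
      assume "N = {}"
      then have "\<And>i. i \<in> I \<Longrightarrow> c i \<ge> 0" by (force simp: N_def)
      then have "\<forall>i\<in>I. c i = 0" using sum_c psubset.hyps by (simp add: sum_nonneg_eq_0_iff)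
      with c(2) show False by blast
    qed
    moreover have "finite N" using psubset.hyps by (simp add: N_def)
    ultimately obtain k where k: "k \<in> N" "\<And>i. i \<in> N \<Longrightarrow> w k / - c k \<le> w i / - c i"
      using arg_min_if_finite(1)[of N "\<lambda>i. w i / - c i"] arg_min_least[of N _ "\<lambda>i. w i / - c i"] by blast
    \<comment> \<open>The first step length at which some weight becomes zero.\<close>
    define s where "s = w k / - c k"
    define u where "u = (\<lambda>i. w i + s * c i)"
    have k_I: "k \<in> I" "c k < 0" using k(1) by (auto simp: N_def)
    have s: "s \<ge> 0" using k_I psubset.prems(2)[of k] by (auto simp: s_def divide_nonneg_neg)
    have u_k: "u k = 0" using k_I by (simp add: u_def s_def)
    have u: "u i \<ge> 0" if "i \<in> I" for i
    proof (cases "c i < 0")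
      case True
      then have "s \<le> w i / - c i" using k(2)[of i] that by (simp add: s_def N_def)
      then have "s * - c i \<le> w i" using True by (simp only: pos_le_divide_eq)
      then show ?thesis by (simp add: u_def)
    next
      case False
      then show ?thesis using s psubset.prems(2)[OF that] by (simp add: u_def)
    qed
    have drop: "(\<Sum>i\<in>I - {k}. u i *\<^sub>R \<phi> i) = (\<Sum>i\<in>I. u i *\<^sub>R \<phi> i)"
      "(\<Sum>i\<in>I - {k}. u i * \<psi> i) = (\<Sum>i\<in>I. u i * \<psi> i)"
      using psubset.hyps k_I u_k by (simp_all add: sum.remove)
    have phi: "(\<Sum>i\<in>I. u i *\<^sub>R \<phi> i) = (\<Sum>i\<in>I. w i *\<^sub>R \<phi> i)"
    proof -
      have "(\<Sum>i\<in>I. u i *\<^sub>R \<phi> i) = (\<Sum>i\<in>I. w i *\<^sub>R \<phi> i) + s *\<^sub>R (\<Sum>i\<in>I. c i *\<^sub>R \<phi> i)"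
        by (simp add: u_def scaleR_add_left sum.distrib scaleR_sum_right)
      then show ?thesis using c(1) by simp
    qed
    have psi: "(\<Sum>i\<in>I. u i * \<psi> i) \<ge> (\<Sum>i\<in>I. w i * \<psi> i)"
    proof -
      have "(\<Sum>i\<in>I. u i * \<psi> i) = (\<Sum>i\<in>I. w i * \<psi> i) + s * (\<Sum>i\<in>I. c i * \<psi> i)"
        by (simp add: u_def distrib_right sum.distrib sum_distrib_left mult.assoc)
      then show ?thesis using c(3) s by simp
    qed
    obtain J v where "J \<subseteq> I - {k}" "card J \<le> DIM('v)" "\<forall>i\<in>J. 0 \<le> v i"
      "(\<Sum>i\<in>J. v i *\<^sub>R \<phi> i) = (\<Sum>i\<in>I - {k}. u i *\<^sub>R \<phi> i)"
      "(\<Sum>i\<in>J. v i * \<psi> i) \<ge> (\<Sum>i\<in>I - {k}. u i * \<psi> i)"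
      using psubset.IH[of "I - {k}" u] psubset.prems(1) u k_I by blast
    then show ?thesis using drop phi psi by (intro exI[of _ J] exI[of _ v]) auto
  qed
qed

section \<open>Finite mixtures of laws\<close>

text \<open>
  Convexity is given for two laws only. The last component is split off, and the remaining
  weights are renormalised unless they all vanish.
\<close>

lemma convex_class_finite_mixture:
  assumes conv: "convex_class \<P>" and sets: "\<And>P. P \<in> \<P> \<Longrightarrow> sets P = \<Sigma>"
    and "finite I" "\<And>i. i \<in> I \<Longrightarrow> K i \<in> \<P>" "\<And>i. i \<in> I \<Longrightarrow> 0 \<le> w i" "(\<Sum>i\<in>I. w i) = 1"
  shows "\<exists>R\<in>\<P>. \<forall>S\<in>\<Sigma>. measure R S = (\<Sum>i\<in>I. w i * measure (K i) S)"
  using assms(3-)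
proof (induction I arbitrary: w rule: finite_induct)
  case empty
  then show ?case by simp
next
  case (insert i I)
  have nn: "\<And>j. j \<in> I \<Longrightarrow> 0 \<le> w j" "0 \<le> w i" using insert.prems by auto
  have total: "w i + (\<Sum>j\<in>I. w j) = 1" using insert by simp
  show ?case
  proof (cases "(\<Sum>j\<in>I. w j) = 0")
    case True
    then have "\<forall>j\<in>I. w j = 0" using nn insert.hyps by (simp add: sum_nonneg_eq_0_iff)
    then show ?thesis using True total insert by (intro bexI[of _ "K i"]) auto
  next
    case False
    let ?s = "\<Sum>j\<in>I. w j"
    have s: "?s > 0" using False nn by (simp add: order_less_le sum_nonneg)
    obtain R where R: "R \<in> \<P>" "\<forall>S\<in>\<Sigma>. measure R S = (\<Sum>j\<in>I. w j / ?s * measure (K j) S)"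
      using insert.IH[of "\<lambda>j. w j / ?s"] insert.prems nn s
      by (auto simp flip: sum_divide_distrib)
    have "w i \<in> {0..1}" using s total nn by auto
    then obtain R' where R': "R' \<in> \<P>" "is_mix (w i) (K i) R R'"
      using conv R(1) insert.prems(1)[of i] unfolding convex_class_def by blast
    have "measure R' S = (\<Sum>j\<in>insert i I. w j * measure (K j) S)" if "S \<in> \<Sigma>" for S
    proof -
      have "measure R' S = w i * measure (K i) S + (1 - w i) * measure R S"
        using R' that sets[OF R'(1)] by (simp add: is_mix_def)
      also have "1 - w i = ?s" using total by simp
      also have "?s * measure R S = (\<Sum>j\<in>I. w j * measure (K j) S)"
        using R(2) that s by (simp add: sum_distrib_left)
      finally show ?thesis using insert.hyps by simp
    qed
    with R' show ?thesis by blast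
  qed
qed

text \<open>
  A combination over fewer than \<open>n\<close> components is padded by repeating one of its components
  with weight zero.
\<close>

lemma convex_comb_ofI:
  assumes I: "finite I" "card I \<le> n" and w: "\<And>i. i \<in> I \<Longrightarrow> 0 \<le> w i" "(\<Sum>i\<in>I. w i) = 1"
    and K: "\<And>i. i \<in> I \<Longrightarrow> K i \<in> \<T>" "\<And>i. i \<in> I \<Longrightarrow> sets (K i) = sets R"
    and mix: "\<And>S. S \<in> sets R \<Longrightarrow> measure R S = (\<Sum>i\<in>I. w i * measure (K i) S)"
  shows "convex_comb_of n \<T> R"
proof -
  obtain b where b: "bij_betw b {..<card I} I"
    using ex_bij_betw_nat_finite[OF I(1)] by (auto simp: atLeast0LessThan)
  have "I \<noteq> {}" using w(2) by auto
  then have pos: "0 < card I" using I(1) by (simp add: card_gt_0_iff)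
  have b_I: "b l \<in> I" if "l < card I" for l using bij_betwE[OF b] that by auto
  define v where "v = (\<lambda>l. if l < card I then w (b l) else 0)"
  define \<mu> where "\<mu> = (\<lambda>l. K (b (if l < card I then l else 0)))"
  have sum: "(\<Sum>l<n. v l * x (\<mu> l)) = (\<Sum>i\<in>I. w i * x (K i))" for x :: "_ \<Rightarrow> real"
  proof -
    have "(\<Sum>l<n. v l * x (\<mu> l)) = (\<Sum>l<card I. v l * x (\<mu> l))"
      using I(2) by (intro sum.mono_neutral_right) (auto simp: v_def)
    also have "\<dots> = (\<Sum>l<card I. w (b l) * x (K (b l)))"
      by (intro sum.cong) (auto simp: v_def \<mu>_def)
    also have "\<dots> = (\<Sum>i\<in>I. w i * x (K i))"
      using sum.reindex_bij_betw[OF b, of "\<lambda>i. w i * x (K i)"] by simp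
    finally show ?thesis .
  qed
  have "(\<Sum>l<n. v l) = 1" using sum[of "\<lambda>_. 1"] w(2) by simp
  moreover have "\<forall>l<n. 0 \<le> v l \<and> \<mu> l \<in> \<T> \<and> sets (\<mu> l) = sets R"
    using pos b_I w(1) K by (auto simp: v_def \<mu>_def)
  moreover have "\<forall>S\<in>sets R. measure R S = (\<Sum>l<n. v l * measure (\<mu> l) S)"
    using mix sum[of "\<lambda>L. measure L S" for S] by simp
  ultimately show ?thesis unfolding convex_comb_of_def by blast
qed

section \<open>Basic laws dominate\<close>

text \<open>
  Reduction in the space of all moments together with the integral of \<open>f\<close> would need one component
  more; giving up equality for \<open>f\<close> in favour of an inequality saves it.
\<close>

lemma exists_basic_law_dominating:
  fixes h :: "'j::finite \<Rightarrow> 'a::topological_space \<Rightarrow> real" and T :: "real^'k \<Rightarrow> 'a measure"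
    and f :: "'a \<Rightarrow> real"
  assumes laws: "\<P> \<subseteq> prob_laws \<Omega>" and conv: "convex_class \<P>"
    and gen: "generated_by \<Omega> \<P> \<Theta> T"
    and h_one: "\<And>x. x \<in> \<Omega> \<Longrightarrow> h j\<^sub>0 x = 1"
    and h: "\<And>P j. P \<in> \<P> \<Longrightarrow> integrable P (h j)"
    and f: "\<And>P. P \<in> \<P> \<Longrightarrow> integrable P f"
    and P: "P \<in> \<P>"
  shows "\<exists>Q\<in>\<P>. convex_comb_of CARD('j) (T ` \<Theta>) Q \<and>
    (\<forall>j. (\<integral>x. h j x \<partial>Q) = (\<integral>x. h j x \<partial>P)) \<and> (\<integral>x. f x \<partial>P) \<le> (\<integral>x. f x \<partial>Q)"
proof -
  have prob: "prob_space R" and sets: "sets R = sets (restrict_space borel \<Omega>)" if "R \<in> \<P>" for R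
    using laws that by (auto simp: prob_laws_def)
  have space: "space R = \<Omega>" if "R \<in> \<P>" for R
    using sets_eq_imp_space_eq[OF sets[OF that]] by (simp add: space_restrict_space)
  have T: "T t \<in> \<P>" if "t \<in> \<Theta>" for t
    using gen that by (auto simp: generated_by_def extreme_law_def)
  obtain M where M: "prob_space M" "sets M = sets (restrict_space borel \<Theta>)"
    and mix: "\<And>S. S \<in> sets P \<Longrightarrow> measure P S = (\<integral>t. measure (T t) S \<partial>M)"
    using gen P sets[OF P] unfolding generated_by_def prob_laws_def by blast
  interpret M: prob_space M by (rule M)
  have space_M: "space M = \<Theta>"
    using sets_eq_imp_space_eq[OF M(2)] by (simp add: space_restrict_space)
  have meas_T: "(\<lambda>t. measure (T t) S) \<in> borel_measurable M" if "S \<in> sets P" for S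
    using gen that sets[OF P] measurable_cong_sets[OF M(2) refl]
    unfolding generated_by_def by blast
  have mean: "integrable M (\<lambda>t. \<integral>x. u x \<partial>T t) \<and> (\<integral>x. u x \<partial>P) = (\<integral>t. (\<integral>x. u x \<partial>T t) \<partial>M)"
    if u: "\<And>R. R \<in> \<P> \<Longrightarrow> integrable R u" for u :: "'a \<Rightarrow> real"
    using integral_mixture[of M P T u, OF M(1) prob[OF P]] T u meas_T mix P
    by (auto simp: space_M prob sets)
  define \<phi> where "\<phi> = (\<lambda>R. \<Sum>j\<in>UNIV. (\<integral>x. h j x \<partial>R) *\<^sub>R axis j (1::real))"
  have phi_nth: "\<phi> R $ j = (\<integral>x. h j x \<partial>R)" for R j
    by (simp add: \<phi>_def axis_def if_distrib cong: if_cong)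
  define \<psi> where "\<psi> = (\<lambda>R. \<integral>x. f x \<partial>R)"
  define F where "F = (\<lambda>t. (\<phi> (T t), \<psi> (T t)))"
  have int_phi: "integrable M (\<lambda>t. \<phi> (T t))" and int_psi: "integrable M (\<lambda>t. \<psi> (T t))"
    using mean[OF h] mean[OF f] by (auto simp: \<phi>_def \<psi>_def)
  have "integrable M (\<lambda>t. (\<phi> (T t), 0) + (0, \<psi> (T t)))"
    using int_phi int_psi
    by (intro Bochner_Integration.integrable_add integrable_bounded_linear[OF bounded_linear_Pair])
       (auto intro: bounded_linear_zero bounded_linear_ident)
  then have int_F: "integrable M F" by (simp add: F_def)
  have "M.expectation F = (\<phi> P, \<psi> P)"
  proof (rule prod_eqI)
    have "fst (M.expectation F) = (\<integral>t. \<phi> (T t) \<partial>M)"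
      using integral_bounded_linear[OF bounded_linear_fst int_F] by (simp add: F_def)
    also have "\<dots> = \<phi> P"
      using mean[OF h] by (simp add: \<phi>_def)
    finally show "fst (M.expectation F) = fst (\<phi> P, \<psi> P)" by simp
    have "snd (M.expectation F) = (\<integral>t. \<psi> (T t) \<partial>M)"
      using integral_bounded_linear[OF bounded_linear_snd int_F] by (simp add: F_def)
    also have "\<dots> = \<psi> P"
      using mean[OF f] by (simp add: \<psi>_def)
    finally show "snd (M.expectation F) = snd (\<phi> P, \<psi> P)" by simp
  qed
  moreover have "M.expectation F \<in> convex hull (F ` \<Theta>)"
    by (rule M.expectation_in_convex_hull_of_AE[OF int_F]) (auto simp flip: space_M)
  ultimately have "(\<phi> P, \<psi> P) \<in> convex hull (F ` \<Theta>)" by simp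
  then obtain S u where S: "finite S" "S \<subseteq> F ` \<Theta>" "\<forall>y\<in>S. 0 \<le> u y"
    "(\<Sum>y\<in>S. u y *\<^sub>R y) = (\<phi> P, \<psi> P)"
    unfolding convex_hull_explicit by auto
  then obtain I where I: "I \<subseteq> \<Theta>" "inj_on F I" "S = F ` I" by (auto simp: subset_image_inj)
  have fin_I: "finite I" using S(1) I finite_imageD by blast
  have "(\<Sum>t\<in>I. u (F t) *\<^sub>R F t) = (\<phi> P, \<psi> P)"
    using S(4) I by (simp add: sum.reindex)
  from arg_cong[OF this, of fst] arg_cong[OF this, of snd]
  have sum_I: "(\<Sum>t\<in>I. u (F t) *\<^sub>R \<phi> (T t)) = \<phi> P" "(\<Sum>t\<in>I. u (F t) * \<psi> (T t)) = \<psi> P"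
    by (simp_all add: fst_sum snd_sum F_def)
  have one: "(\<integral>x. h j\<^sub>0 x \<partial>R) = 1" if "R \<in> \<P>" for R
  proof -
    have "(\<integral>x. h j\<^sub>0 x \<partial>R) = (\<integral>x. 1 \<partial>R)"
      by (rule Bochner_Integration.integral_cong) (use h_one space[OF that] in auto)
    then show ?thesis using prob_space.prob_space[OF prob[OF that]] by simp
  qed
  have "\<phi> (T t) \<bullet> axis j\<^sub>0 1 = 1" if "t \<in> I" for t
    using that I(1) T one by (auto simp: inner_axis phi_nth)
  moreover have "0 \<le> u (F t)" if "t \<in> I" for t
    using that S(3) I(3) by simp
  ultimately have "\<exists>J w. J \<subseteq> I \<and> card J \<le> DIM(real^'j) \<and> (\<forall>t\<in>J. 0 \<le> w t) \<and>
    (\<Sum>t\<in>J. w t *\<^sub>R \<phi> (T t)) = (\<Sum>t\<in>I. u (F t) *\<^sub>R \<phi> (T t)) \<and>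
    (\<Sum>t\<in>J. w t * \<psi> (T t)) \<ge> (\<Sum>t\<in>I. u (F t) * \<psi> (T t))"
    by (rule reduce_support[OF fin_I])
  then obtain J w where J: "J \<subseteq> I" "card J \<le> CARD('j)" "\<And>t. t \<in> J \<Longrightarrow> 0 \<le> w t"
    "(\<Sum>t\<in>J. w t *\<^sub>R \<phi> (T t)) = \<phi> P" "(\<Sum>t\<in>J. w t * \<psi> (T t)) \<ge> \<psi> P"
    unfolding sum_I by auto
  have fin_J: "finite J" using J(1) fin_I finite_subset by blast
  have J_\<P>: "T t \<in> \<P>" if "t \<in> J" for t using that J(1) I(1) T by blast
  have moments: "(\<Sum>t\<in>J. w t * (\<integral>x. h j x \<partial>T t)) = (\<integral>x. h j x \<partial>P)" for j
    using arg_cong[OF J(4), of "\<lambda>v. v $ j"] by (simp add: phi_nth)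
  \<comment> \<open>The weights sum to one because \<open>h j\<^sub>0\<close> is among the moment functions.\<close>
  have sum_w: "(\<Sum>t\<in>J. w t) = 1"
    using moments[of j\<^sub>0] one J_\<P> P by simp
  obtain Q where Q: "Q \<in> \<P>"
    and mix_Q: "\<And>S. S \<in> sets Q \<Longrightarrow> measure Q S = (\<Sum>t\<in>J. w t * measure (T t) S)"
    using convex_class_finite_mixture[where K = T, OF conv sets fin_J J_\<P> J(3) sum_w] sets by auto
  have int_Q: "(\<integral>x. v x \<partial>Q) = (\<Sum>t\<in>J. w t * (\<integral>x. v x \<partial>T t))"
    if "\<And>R. R \<in> \<P> \<Longrightarrow> integrable R v" for v :: "'a \<Rightarrow> real"
    by (rule integral_finite_mixture[OF fin_J J(3) sum_w])
       (use Q mix_Q J_\<P> that in \<open>auto simp: prob sets\<close>)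
  have "convex_comb_of CARD('j) (T ` \<Theta>) Q"
    by (rule convex_comb_ofI[OF fin_J J(2,3) sum_w])
       (use Q mix_Q J_\<P> J(1) I(1) in \<open>auto simp: sets\<close>)
  then show ?thesis
    using Q int_Q[OF h] int_Q[OF f] moments J(5) by (auto simp: \<psi>_def)
qed

section \<open>Conditional expectations\<close>

text \<open>
  The linear test function \<open>(g - v) 1\<^sub>\<Xi>\<close> decides whether a conditional expectation reaches \<open>v\<close>.
\<close>

lemma le_cond_expect_iff:
  assumes pos: "0 < measure P \<Xi>" and \<Xi>: "\<Xi> \<in> sets P"
    and g: "integrable P (\<lambda>x. g x * indicator \<Xi> x)"
  shows "v \<le> cond_expect P g \<Xi> \<longleftrightarrow> 0 \<le> (\<integral>x. (g x - v) * indicator \<Xi> x \<partial>P)"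
proof -
  have fin: "emeasure P \<Xi> < \<infinity>"
    using pos by (cases "emeasure P \<Xi> = \<infinity>") (auto simp: Sigma_Algebra.measure_def less_top)
  have "(\<integral>x. (g x - v) * indicator \<Xi> x \<partial>P) = (\<integral>x. g x * indicator \<Xi> x - v * indicator \<Xi> x \<partial>P)"
    by (simp add: left_diff_distrib)
  also have "\<dots> = (\<integral>x. g x * indicator \<Xi> x \<partial>P) - v * measure P \<Xi>"
    using \<Xi> g fin by (simp add: sets.Int_space_eq2)
  finally show ?thesis
    using pos \<Xi> by (simp add: cond_expect_def pos_le_divide_eq sets.Int_space_eq2)
qed

theorem theorem2:
  fixes \<Omega> \<Xi> :: "(real^'n) set"
    and g :: "real^'n \<Rightarrow> real"
    and h :: "'j::finite \<Rightarrow> real^'n \<Rightarrow> real"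
    and j\<^sub>0 :: 'j
    and m :: nat
    and q :: "real^'j"
    and \<P>\<^sub>0 :: "(real^'n) measure set"
    and \<Theta> :: "(real^'k) set"
    and T :: "real^'k \<Rightarrow> (real^'n) measure"
  assumes "closed \<Omega>"
    and "\<Xi> \<subseteq> \<Omega>" and "\<Xi> \<in> sets borel"
    and "g \<in> borel_measurable (restrict_space borel \<Omega>)"
    and "\<And>j. h j \<in> borel_measurable (restrict_space borel \<Omega>)"
    and "CARD('j) = m + 1"
    and "\<And>x. x \<in> \<Omega> \<Longrightarrow> h j\<^sub>0 x = 1"
    and "q $ j\<^sub>0 = 1"
    and "\<P>\<^sub>0 \<subseteq> prob_laws \<Omega>"
    and "convex_class \<P>\<^sub>0"
    and "generated_by \<Omega> \<P>\<^sub>0 \<Theta> T"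
    and "\<And>P j. P \<in> \<P>\<^sub>0 \<Longrightarrow> integrable P (h j)"
    and "moment_class \<P>\<^sub>0 h q \<noteq> {}"
    and A1: "bounded (g ` \<Omega>)"
    and A2: "\<exists>\<epsilon>>0. (INF P\<in>moment_class \<P>\<^sub>0 h q. measure P \<Xi>) \<ge> \<epsilon>"
    and A3: "q \<in> interior (moment_cone \<P>\<^sub>0 h)"
  shows "(SUP P\<in>moment_class \<P>\<^sub>0 h q. ereal (cond_expect P g \<Xi>)) =
           (SUP P\<in>basic_class \<P>\<^sub>0 (T ` \<Theta>) h q. ereal (cond_expect P g \<Xi>)) \<and>
         ((\<exists>P\<in>moment_class \<P>\<^sub>0 h q. ereal (cond_expect P g \<Xi>) =
              (SUP P'\<in>moment_class \<P>\<^sub>0 h q. ereal (cond_expect P' g \<Xi>))) \<longrightarrow>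
          (\<exists>P\<in>basic_class \<P>\<^sub>0 (T ` \<Theta>) h q. convex_comb_of (m + 1) (T ` \<Theta>) P \<and>
             ereal (cond_expect P g \<Xi>) =
              (SUP P'\<in>moment_class \<P>\<^sub>0 h q. ereal (cond_expect P' g \<Xi>))))"
proof -
  let ?C = "moment_class \<P>\<^sub>0 h q" and ?B = "basic_class \<P>\<^sub>0 (T ` \<Theta>) h q"
  let ?E = "\<lambda>P. cond_expect P g \<Xi>"
  note laws = \<open>\<P>\<^sub>0 \<subseteq> prob_laws \<Omega>\<close>
  obtain \<epsilon> where \<epsilon>: "\<epsilon> > 0" "\<epsilon> \<le> (INF P\<in>?C. measure P \<Xi>)" using A2 by blast
  have pos: "0 < measure P \<Xi>" if "P \<in> ?C" for P
  proof -
    have "bdd_below ((\<lambda>P. measure P \<Xi>) ` ?C)" by (rule bdd_belowI[of _ 0]) auto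
    from cINF_lower[OF this that] show ?thesis using \<epsilon> by linarith
  qed
  obtain b where b: "\<And>x. x \<in> \<Omega> \<Longrightarrow> \<bar>g x\<bar> \<le> b" using A1 by (auto simp: bounded_iff)
  have prob: "prob_space P" and sets: "sets P = sets (restrict_space borel \<Omega>)" if "P \<in> \<P>\<^sub>0" for P
    using laws that by (auto simp: prob_laws_def)
  have space: "space P = \<Omega>" if "P \<in> \<P>\<^sub>0" for P
    using sets_eq_imp_space_eq[OF sets[OF that]] by (simp add: space_restrict_space)
  have \<Xi>: "\<Xi> \<in> sets P" if "P \<in> \<P>\<^sub>0" for P
    unfolding sets[OF that] sets_restrict_space using assms(2,3) by blast
  have int: "integrable P (\<lambda>x. (g x - v) * indicator \<Xi> x)" if P: "P \<in> \<P>\<^sub>0" for P v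
  proof -
    interpret prob_space P by (rule prob[OF P])
    have [measurable]: "g \<in> borel_measurable P"
      using assms(4) measurable_cong_sets[OF sets[OF P] refl] by blast
    have [measurable]: "\<Xi> \<in> sets P" by (rule \<Xi>[OF P])
    have "\<bar>(g x - v) * indicator \<Xi> x\<bar> \<le> b + \<bar>v\<bar>" if "x \<in> space P" for x
      using b[of x] that space[OF P] by (auto simp: indicator_def)
    then show ?thesis by (intro integrable_const_bound[where B="b + \<bar>v\<bar>"]) auto
  qed
  have C_iff: "v \<le> ?E P \<longleftrightarrow> 0 \<le> (\<integral>x. (g x - v) * indicator \<Xi> x \<partial>P)" if "P \<in> ?C" for P v
  proof (rule le_cond_expect_iff)
    have P: "P \<in> \<P>\<^sub>0" using that by (simp add: moment_class_def)
    show "\<Xi> \<in> sets P" by (rule \<Xi>[OF P])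
    show "integrable P (\<lambda>x. g x * indicator \<Xi> x)" using int[OF P, of 0] by simp
  qed (rule pos[OF that])
  \<comment> \<open>The reference value is the conditional expectation under the given law itself.\<close>
  have improve: "\<exists>Q\<in>?B. convex_comb_of (m + 1) (T ` \<Theta>) Q \<and> ?E P \<le> ?E Q" if P: "P \<in> ?C" for P
  proof -
    have P0: "P \<in> \<P>\<^sub>0" using P by (simp add: moment_class_def)
    let ?f = "\<lambda>x. (g x - ?E P) * indicator \<Xi> x"
    obtain Q where Q: "Q \<in> \<P>\<^sub>0" "convex_comb_of CARD('j) (T ` \<Theta>) Q"
      "\<And>j. (\<integral>x. h j x \<partial>Q) = (\<integral>x. h j x \<partial>P)" "(\<integral>x. ?f x \<partial>P) \<le> (\<integral>x. ?f x \<partial>Q)"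
      using exists_basic_law_dominating[where f = ?f and h = h, OF laws assms(10,11,7,12) int P0] by blast
    have "Q \<in> ?C" using Q(1,3) P by (simp add: moment_class_def)
    moreover from this have "?E P \<le> ?E Q"
      using Q(4) C_iff[OF P, of "?E P"] C_iff[of Q "?E P"] by simp
    ultimately show ?thesis using Q(2) \<open>CARD('j) = m + 1\<close> by (auto simp: basic_class_def)
  qed
  have "?B \<subseteq> ?C" by (auto simp: basic_class_def)
  then have le: "(SUP P\<in>?B. ereal (?E P)) \<le> (SUP P\<in>?C. ereal (?E P))"
    by (rule SUP_subset_mono) simp
  have ge: "(SUP P\<in>?C. ereal (?E P)) \<le> (SUP P\<in>?B. ereal (?E P))"
    by (rule SUP_mono) (use improve in \<open>auto simp: Bex_def\<close>)
  have "\<exists>Q\<in>?B. convex_comb_of (m + 1) (T ` \<Theta>) Q \<and> ereal (?E Q) = (SUP P'\<in>?C. ereal (?E P'))"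
    if P: "P \<in> ?C" "ereal (?E P) = (SUP P'\<in>?C. ereal (?E P'))" for P
  proof -
    obtain Q where Q: "Q \<in> ?B" "convex_comb_of (m + 1) (T ` \<Theta>) Q" "?E P \<le> ?E Q"
      using improve[OF P(1)] by blast
    have "ereal (?E Q) \<le> (SUP P'\<in>?C. ereal (?E P'))"
      by (rule SUP_upper) (use Q(1) \<open>?B \<subseteq> ?C\<close> in blast)
    moreover have "(SUP P'\<in>?C. ereal (?E P')) \<le> ereal (?E Q)"
      using Q(3) unfolding P(2)[symmetric] by simp
    ultimately show ?thesis using Q(1,2) antisym by blast
  qed
  with le ge show ?thesis by (blast intro: antisym)
qed

end
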